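(* Let $n\ge 5$ and let $\lambda\in(0,\infty)$. If $A$ is a convex $n$-gon in $\mathbb{RP}^2$, then $H_\lambda(A)$ is a convex $n$-gon. In other words, $H_\lambda(\mathcal{C}_n)\subset\mathcal{C}_n$, and consequently the map induced by $H_\lambda$ on projective equivalence classes satisfies $H_\lambda(\mathfrak{C}_n)\subset\mathfrak{C}_n$.
   Context: An $n$-gon is an ordered $n$-tuple $A=(A_0,A_2,\dots,A_{2n-2})$ of points of $\mathbb{RP}^2$, with (even) indices taken modulo $2n$. It is generic if no three of its vertices are collinear. It is convex if some projective transformation carries it to an $n$-gon in the affine plane $\mathbb{R}^2\subset\mathbb{RP}^2$ whose vertices are, in cyclic order, the vertices of a strictly convex polygon (so convex $n$-gons are generic). $\mathcal{C}_n$ is the set of convex $n$-gons and $\mathfrak{C}_n=\mathcal{C}_n/PGL(3,\mathbb{R})$ the set of their projective equivalence classes. The heat map $H_\lambda$: Let $\lambda\in\mathbb{R}\cup\{\infty\}$. For four points $a,b,c,d$ of $\mathbb{RP}^2$ (in this order), no three collinear, let $T\in PGL(3,\mathbb{R})$ be the unique projective transformation with $T(a)=(-1,1)$, $T(b)=(1,1)$, $T(c)=(1,-1)$, $T(d)=(-1,-1)$ (coordinates in the affine patch $\mathbb{R}^2\subset\mathbb{RP}^2$), and set $h_\lambda(a,b,c,d)=T^{-1}(\lambda,0)$, where for $\lambda=\infty$ the point $(\infty,0)$ means the point at infinity of the $x$-axis. For a generic $n$-gon $A$, $H_\lambda(A)$ is the $n$-gon $B=(B_1,B_3,\dots,B_{2n-1})$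 with $B_{2i+3}=h_\lambda(A_{2i},A_{2i+2},A_{2i+4},A_{2i+6})$ for all $i$ (indices modulo $2n$). The construction commutes with projective transformations, hence induces a map on projective equivalence classes. *)

theory Defs
  imports "HOL-Analysis.Analysis"
begin

typedef rp2 = "{L :: (real^3) set. subspace L \<and> dim L = 1}"
  by (rule exI[of _ "span {axis 1 1}"]) (simp add: dim_span dim_singleton)

text \<open>The inclusion of the affine patch, sending $(x,y)$ to $[x:y:1]$.\<close>

definition aff :: "real^2 \<Rightarrow> rp2" where
  "aff x = Abs_rp2 (span {vector [x $ 1, x $ 2, 1]})"

definition proj_map :: "real^3^3 \<Rightarrow> rp2 \<Rightarrow> rp2" where
  "proj_map M p = Abs_rp2 ((*v) M ` Rep_rp2 p)"

text \<open>Elements of $PGL(3)$ are identified with the permutations of the projective plane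
  they induce; this action is faithful.\<close>

definition PGL3 :: "(rp2 \<Rightarrow> rp2) set" where
  "PGL3 = {proj_map M | M. invertible M}"

text \<open>The cyclic order is expressed by requiring that consecutive points span edges of the
  polygon; strictness by requiring that every point is a genuine corner.\<close>

definition strictly_convex_polygon :: "(real^2) list \<Rightarrow> bool" where
  "strictly_convex_polygon xs \<longleftrightarrow>
     3 \<le> length xs \<and> distinct xs \<and>
     {x. x extreme_point_of (convex hull (set xs))} = set xs \<and>
     (\<forall>i<length xs. closed_segment (xs ! i) (xs ! (Suc i mod length xs))
                       edge_of (convex hull (set xs)))"

definition convex_ngons :: "nat \<Rightarrow> rp2 list set" where
  "convex_ngons n = {A. length A = n \<and>
     (\<exists>T\<in>PGL3. \<exists>xs. strictly_convex_polygon xs \<and> map T A = map aff xs)}"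

definition proj_equiv :: "(rp2 list \<times> rp2 list) set" where
  "proj_equiv = {(A, B). \<exists>T\<in>PGL3. B = map T A}"

definition convex_classes :: "nat \<Rightarrow> rp2 list set set" where
  "convex_classes n = convex_ngons n // proj_equiv"

text \<open>The normalization below exists and is unique when no three of the four points are
  collinear; otherwise its value is irrelevant.\<close>

definition to_square :: "rp2 \<Rightarrow> rp2 \<Rightarrow> rp2 \<Rightarrow> rp2 \<Rightarrow> rp2 \<Rightarrow> rp2" where
  "to_square a b c d = (THE T. T \<in> PGL3 \<and>
     T a = aff (vector [-1, 1]) \<and> T b = aff (vector [1, 1]) \<and>
     T c = aff (vector [1, -1]) \<and> T d = aff (vector [-1, -1]))"

definition heat_point :: "real \<Rightarrow> rp2 \<Rightarrow> rp2 \<Rightarrow> rp2 \<Rightarrow> rp2 \<Rightarrow> rp2" where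
  "heat_point lam a b c d = inv (to_square a b c d) (aff (vector [lam, 0]))"

text \<open>Position $j$ of an input list holds the vertex $A_{2j}$ and position $j$ of the output
  list holds $B_{2j+1}$, so that $B_{2j+1}$ is built from the positions $j-1, j, j+1, j+2$.\<close>

definition heat_map :: "real \<Rightarrow> rp2 list \<Rightarrow> rp2 list" where
  "heat_map lam A = (let n = length A in
     map (\<lambda>j. heat_point lam (A ! ((j + n - 1) mod n)) (A ! j)
                             (A ! ((j + 1) mod n)) (A ! ((j + 2) mod n))) [0..<n])"

text \<open>The induced map on classes. The union is a single equivalence class precisely when
  the class of the image does not depend on the representative.\<close>

definition heat_map_class :: "real \<Rightarrow> rp2 list set \<Rightarrow> rp2 list set" where
  "heat_map_class lam X = (\<Union>A\<in>X. proj_equiv `` {heat_map lam A})"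

end

theory Submission imports Defs begin

text \<open>
  A convex $n$-gon is lifted to an $n$-periodic sequence of vectors $v_i$ of $\mathbb{R}^3$ all of
  whose triple products $[v_i, v_j, v_k]$ with $i < j < k < i + n$ are positive. For consecutive
  lifts $a, b, c, d$ rescaled to $a', b', c', d'$ with $a' + c' = b' + d'$, the heat vertex is
  $w = o + \lambda e$, where $o = a' + c' = b' + d'$ is the intersection of the diagonals and
  $e = b' - a' = c' - d'$ is the intersection of the lines $ab$ and $cd$.

  Let $L = [w, w', \cdot]$ define the edge of the image polygon between the heat vertices $w$ and
  $w'$ of the edges $bc$ and $cd$. Pluecker relations give $L(b) > 0$, $L(d) > 0$ and $L(e) < 0$.
  Every further heat vertex, except the one of $ab$, lies on the nonnegative side of the lines $ab$
  and $cd$ and on the positive side of $bd$, so it is a combination $x b + y d - z e$ with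
  $x, y \ge 0$ and $z > 0$, and $L$ is positive on it. The exception is the previous edge seen from
  its other end: cyclic invariance of the triple product reduces it to a case already covered.
\<close>

subsection \<open>Triple products and the heat vertex\<close>

text \<open>The determinant with rows \<open>x\<close>, \<open>y\<close>, \<open>z\<close>, written
  in coordinates so that bracket identities reduce to polynomial expansion.\<close>

definition br :: "real^3 \<Rightarrow> real^3 \<Rightarrow> real^3 \<Rightarrow> real" where
  "br x y z = x$1 * (y$2 * z$3 - y$3 * z$2) - x$2 * (y$1 * z$3 - y$3 * z$1) + x$3 * (y$1 * z$2 - y$2 * z$1)"

lemma br_cycle: "br x y z = br y z x"
  by (simp add: br_def algebra_simps)

lemma br_swap: "br x z y = - br x y z"
  by (simp add: br_def algebra_simps)

lemma br_refl [simp]: "br x x y = 0" "br x y x = 0" "br x y y = 0"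
  by (simp_all add: br_def algebra_simps)

lemma br_lin3:
  "br x y (z + z') = br x y z + br x y z'" "br x y (z - z') = br x y z - br x y z'"
  "br x y (c *\<^sub>R z) = c * br x y z"
  by (simp_all add: br_def algebra_simps)

lemma br_scale:
  "br (c *\<^sub>R x) y z = c * br x y z" "br x (c *\<^sub>R y) z = c * br x y z" "br x y (c *\<^sub>R z) = c * br x y z"
  by (simp_all add: br_def algebra_simps)

text \<open>The three-term Grassmann-Pluecker relation pivoted at \<open>x\<close>. For vectors in
  convex order it has no negative term, so positivity of five brackets gives that of the
  sixth.\<close>

lemma br_pluecker: "br x a c * br x b d = br x a b * br x c d + br x a d * br x b c"
  by (simp add: br_def algebra_simps)

text \<open>Cramer's rule for \<open>v\<close> with respect to \<open>p\<close>, \<open>q\<close>,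
  \<open>r\<close>, after applying the functional \<open>br y z\<close> to both sides.\<close>

lemma br_cramer:
  "br p q r * br y z v = br v q r * br y z p + br p v r * br y z q + br p q v * br y z r"
  by (simp add: br_def algebra_simps)

text \<open>The linear dependence of four vectors in three-space; its coefficients are the
  rescalings that make \<open>a' + c' = b' + d'\<close>.\<close>

lemma br_relation:
  "br b c d *\<^sub>R a + br a b d *\<^sub>R c = br a c d *\<^sub>R b + br a b c *\<^sub>R d"
  by (simp add: br_def vec_eq_iff forall_3 algebra_simps)

text \<open>In the square frame this becomes the point at infinity of the x-axis, where the
  horizontal sides \<open>ab\<close> and \<open>cd\<close> meet.\<close>

definition outer :: "real^3 \<Rightarrow> real^3 \<Rightarrow> real^3 \<Rightarrow> real^3 \<Rightarrow> real^3" where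
  "outer a b c d = br a c d *\<^sub>R b - br b c d *\<^sub>R a"

text \<open>The square frame sends the diagonal point to (0,0,2) and the outer vector to (2,0,0), so
  this vector spans [lam : 0 : 1].\<close>

definition heat_vec :: "real \<Rightarrow> real^3 \<Rightarrow> real^3 \<Rightarrow> real^3 \<Rightarrow> real^3 \<Rightarrow> real^3" where
  "heat_vec lam a b c d = br b c d *\<^sub>R a + br a b d *\<^sub>R c + lam *\<^sub>R outer a b c d"

lemma outer_alt: "outer a b c d = br a b d *\<^sub>R c - br a b c *\<^sub>R d"
  using br_relation[of b c d a] by (simp add: outer_def algebra_simps)

lemma heat_vec_alt:
  "heat_vec lam a b c d = br a c d *\<^sub>R b + br a b c *\<^sub>R d + lam *\<^sub>R outer a b c d"
  using br_relation[of b c d a] by (simp add: heat_vec_def)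

text \<open>The sign of this triple product says on which side of $pq$ the lines $ab$ and $cd$ meet; it is
  not a product of brackets, but becomes subtraction-free after multiplication by $[p, a, c]$.\<close>

lemma br_outer_nonneg:
  assumes "br p a c > 0" "br p q c \<ge> 0" "br p a b \<ge> 0" "br a c d \<ge> 0"
    "br p q a \<ge> 0" "br a b c \<ge> 0" "br p c d \<ge> 0"
  shows "br p q (outer a b c d) \<ge> 0"
proof -
  \<comment> \<open>Both Pluecker relations introduce \<open>br p a d\<close>, on whose sign nothing
    is assumed; the terms containing it cancel below.\<close>
  have q: "br p a c * br p q d = br p q c * br p a d - br p q a * br p c d"
    by (simp add: br_def algebra_simps)
  have b: "br p a c * br a b d = br p a b * br a c d + br a b c * br p a d"
    by (simp add: br_def algebra_simps)
  have "br p a c * br p q (outer a b c d)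
      = br p q c * (br p a c * br a b d) - br a b c * (br p a c * br p q d)"
    by (simp add: outer_alt br_lin3 algebra_simps)
  also have "\<dots> = br p q c * br p a b * br a c d + br p q a * br a b c * br p c d"
    unfolding q b by (simp add: algebra_simps)
  also have "\<dots> \<ge> 0" using assms by simp
  finally show ?thesis using assms(1) by (simp add: zero_le_mult_iff)
qed

text \<open>Multiples of \<open>b\<close> drop out against the third argument. With the first vertex
  written through \<open>b\<close> and \<open>d\<close>, a single negative term survives, and a
  Pluecker relation absorbs it.\<close>

lemma heat_edge_left:
  assumes "lam > 0" "br a b c > 0" "br a b d > 0" "br b c d > 0" "br a b e > 0" "br b d e > 0"
    "br b c e > 0"
  shows "br (heat_vec lam a b c d) (heat_vec lam b c d e) b > 0"
proof -
  \<comment> \<open>The scale factors stay free variables here; expanding them as brackets would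
    raise the degree of the identity needlessly.\<close>
  have gen: "br (x *\<^sub>R b + y *\<^sub>R d + lam *\<^sub>R (x *\<^sub>R b - z *\<^sub>R a)) (x2 *\<^sub>R b + y2 *\<^sub>R d + lam *\<^sub>R (z2 *\<^sub>R c - x2 *\<^sub>R b)) b
     = lam * (z * y2 * br a b d - y * z2 * br b c d + lam * z * z2 * br a b c)" for x y z x2 y2 z2
    by (simp add: br_def algebra_simps)
  \<comment> \<open>The Pluecker relation pivoted at \<open>b\<close>; it makes the difference of
    the two terms linear in \<open>lam\<close> positive.\<close>
  have "br b c e * br a b d - br a b c * br b d e = br b c d * br a b e"
    by (simp add: br_def algebra_simps)
  then have "br b c d * (br b c e * br a b d) - br b c d * (br a b c * br b d e) = br b c d * (br b c d * br a b e)"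
    by (simp flip: right_diff_distrib)
  moreover have "0 < lam * br b c d * br b d e * br a b c" "0 < br b c d * (br b c d * br a b e)"
    using assms by simp_all
  ultimately have "0 < br b c d * br b c e * br a b d - br a b c * br b d e * br b c d 
    + lam * br b c d * br b d e * br a b c"
    by (simp add: algebra_simps)
  then show ?thesis using assms(1)
    unfolding heat_vec_alt[of lam a b c d] heat_vec_def[of lam b c d e] outer_def gen by simp
qed

text \<open>Reversing the order of the vertices flips every bracket, and negating all vectors flips
  it back. This symmetry carries the estimate at \<open>b\<close> over to the one at
  \<open>d\<close>.\<close>

lemma heat_vec_mirror: "heat_vec lam (-d) (-c) (-b) (-a) = - heat_vec lam a b c d"
proof -
  have "br (-z) (-y) (-x) = br x y z" for x y z by (simp add: br_def algebra_simps)
  then show ?thesis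
    unfolding heat_vec_def[of lam "-d"] heat_vec_alt[of lam a] outer_def[of "-d"] outer_alt[of a]
    by (simp add: algebra_simps)
qed

lemma heat_edge_right:
  assumes "lam > 0" "br c d e > 0" "br b d e > 0" "br b c d > 0" "br a d e > 0" "br a b d > 0"
    "br a c d > 0"
  shows "br (heat_vec lam a b c d) (heat_vec lam b c d e) d > 0"
proof -
  have neg: "br (-z) (-y) (-x) = br x y z" for x y z by (simp add: br_def algebra_simps)
  have "br (heat_vec lam (-e) (-d) (-c) (-b)) (heat_vec lam (-d) (-c) (-b) (-a)) (-d) > 0"
    using assms by (intro heat_edge_left) (simp_all add: neg)
  then show ?thesis by (simp add: heat_vec_mirror br_def algebra_simps)
qed

text \<open>The outer part of the first vertex drops out against the third argument, so its brackets
  with \<open>b\<close>, \<open>c\<close>, \<open>d\<close> are monomials. Expanding the second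
  vertex in \<open>b\<close>, \<open>c\<close>, \<open>d\<close> leaves one difference of mixed
  sign, which a Pluecker relation pivoted at \<open>c\<close> turns into a product.\<close>

lemma heat_edge_outer:
  assumes "lam > 0" "br a b c > 0" "br a b d > 0" "br b c d > 0" "br a c d > 0" "br b d e > 0"
    "br c d e > 0" "br a c e > 0"
  shows "br (heat_vec lam a b c d) (heat_vec lam b c d e) (outer a b c d) < 0"
proof -
  let ?u = "heat_vec lam a b c d" and ?e = "outer a b c d"
  have "br (x *\<^sub>R b + y *\<^sub>R d + lam *\<^sub>R (x *\<^sub>R b - z *\<^sub>R a)) b (x *\<^sub>R b - z *\<^sub>R a) = y * z * br a b d" for x y z
    by (simp add: br_def algebra_simps)
  then have ub: "br ?u b ?e = br a b c * br b c d * br a b d"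
    unfolding heat_vec_alt outer_def .
  have "br (z *\<^sub>R a + y *\<^sub>R c + lam *\<^sub>R (x *\<^sub>R b - z *\<^sub>R a)) c (x *\<^sub>R b - z *\<^sub>R a) = - x * z * br a b c" for x y z
    by (simp add: br_def algebra_simps)
  then have uc: "br ?u c ?e = - br a c d * br b c d * br a b c"
    unfolding heat_vec_def outer_def .
  have "br (x *\<^sub>R b + y *\<^sub>R d + lam *\<^sub>R (x *\<^sub>R b - z *\<^sub>R a)) d (x *\<^sub>R b - z *\<^sub>R a) = - x * z * br a b d" for x y z
    by (simp add: br_def algebra_simps)
  then have ud: "br ?u d ?e = - br a c d * br b c d * br a b d"
    unfolding heat_vec_alt outer_def .
  have "br ?u (x *\<^sub>R b + y *\<^sub>R d + lam *\<^sub>R (z *\<^sub>R c - x *\<^sub>R b)) ?e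
     = x * br ?u b ?e + y * br ?u d ?e + lam * (z * br ?u c ?e - x * br ?u b ?e)" for x y z
    by (simp add: br_def algebra_simps)
  then have "br ?u (heat_vec lam b c d e) ?e = br c d e * br ?u b ?e + br b c e * br ?u d ?e
     + lam * (br b d e * br ?u c ?e - br c d e * br ?u b ?e)"
    unfolding heat_vec_def[of lam b] outer_def[of b] .
  also have "\<dots> = - br b c d * br a b d * (br a c d * br b c e - br a b c * br c d e)
     - lam * (br b d e * br a c d * br b c d * br a b c + br c d e * br a b c * br b c d * br a b d)"
    by (simp add: ub uc ud algebra_simps)
  also have "br a c d * br b c e - br a b c * br c d e = br b c d * br a c e"
    by (simp add: br_def algebra_simps)
  finally have "- br ?u (heat_vec lam b c d e) ?e = br b c d * br a b d * (br b c d * br a c e)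
     + lam * (br b d e * br a c d * br b c d * br a b c + br c d e * br a b c * br b c d * br a b d)"
    by simp
  also have "\<dots> > 0" using assms by (intro add_pos_pos mult_pos_pos)
  finally show ?thesis by simp
qed

subsection \<open>Convex lifts\<close>

text \<open>Only triples containing an edge are constrained; \<open>convex_lift_pos\<close> supplies
  the rest. Periodicity needs no sign twist, because rotating a triple is an even
  permutation.\<close>

definition convex_lift :: "int \<Rightarrow> (int \<Rightarrow> real^3) \<Rightarrow> bool" where
  "convex_lift n v \<longleftrightarrow> (\<forall>i. v (i + n) = v i) \<and>
     (\<forall>i j. i + 1 < j \<longrightarrow> j < i + n \<longrightarrow> br (v i) (v (i + 1)) (v j) > 0)"

text \<open>Induction on \<open>k\<close>. The Pluecker relation pivoted at \<open>v i\<close>, with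
  \<open>v (i + 1)\<close> as auxiliary vector, reduces the triple ending in \<open>k + 1\<close> to
  edge triples and to the triple ending in \<open>k\<close>.\<close>

lemma convex_lift_pos:
  assumes v: "convex_lift n v" and ijk: "i < j" "j < k" "k < i + n"
  shows "br (v i) (v j) (v k) > 0"
proof -
  note per = v[unfolded convex_lift_def, THEN conjunct1, rule_format]
  note edge = v[unfolded convex_lift_def, THEN conjunct2, rule_format]
  have "\<forall>j. i < j \<longrightarrow> j < k \<longrightarrow> br (v i) (v j) (v k) > 0" if "i + 2 \<le> k" "k < i + n" for k
    using that
  proof (induction k rule: int_ge_induct)
    case base
    show ?case
    proof (intro allI impI)
      fix j assume "i < j" "j < i + 2"
      then have "j = i + 1" by linarith
      then show "br (v i) (v j) (v (i + 2)) > 0" using edge[of i "i + 2"] base by simp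
    qed
  next
    case (step k)
    show ?case
    proof (intro allI impI)
      fix j assume j: "i < j" "j < k + 1"
      have kk: "br (v i) (v k) (v (k + 1)) > 0"
        using edge[of k "i + n"] step.prems step.hyps by (simp add: per br_cycle[of "v i"])
      show "br (v i) (v j) (v (k + 1)) > 0"
      proof (cases "j = k \<or> j = i + 1")
        case True
        then show ?thesis using kk edge[of i "k + 1"] step by auto
      next
        case False
        then have "br (v i) (v (i + 1)) (v j) > 0" "br (v i) (v (i + 1)) (v k) > 0"
          "br (v i) (v (i + 1)) (v (k + 1)) > 0" "br (v i) (v j) (v k) > 0"
          using j step edge[of i] by auto
        then have "br (v i) (v (i + 1)) (v k) * br (v i) (v j) (v (k + 1)) > 0"
          using kk unfolding br_pluecker[of "v i" "v (i + 1)" "v k"] by (simp add: add_pos_pos)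
        then show ?thesis using \<open>br (v i) (v (i + 1)) (v k) > 0\<close> by (simp add: zero_less_mult_iff)
      qed
    qed
  qed
  then show ?thesis using ijk by simp
qed

text \<open>At the boundary of the index range two of the vectors coincide and the bracket vanishes;
  for \<open>k = i + n\<close> this is periodicity.\<close>

lemma convex_lift_nonneg:
  assumes v: "convex_lift n v" and ijk: "i \<le> j" "j \<le> k" "k \<le> i + n"
  shows "br (v i) (v j) (v k) \<ge> 0"
proof -
  have "v (i + n) = v i" using v by (simp add: convex_lift_def)
  moreover have "i = j \<or> j = k \<or> k = i + n \<or> i < j \<and> j < k \<and> k < i + n"
    using ijk by linarith
  ultimately show ?thesis using convex_lift_pos[OF v, of i j k] by auto
qed

lemma convex_lift_periodic:
  assumes v: "convex_lift n v"
  shows "v (i + m * n) = v i"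
proof -
  have per: "v (i + n) = v i" for i using v by (simp add: convex_lift_def)
  show ?thesis
  proof (induction m rule: int_induct[where k = 0])
    case (step1 m)
    then show ?case using per[of "i + m * n"] by (simp add: algebra_simps)
  next
    case (step2 m)
    then show ?case using per[of "i + (m - 1) * n"] by (simp add: algebra_simps)
  qed simp
qed

lemma convex_lift_edge_nonneg:
  assumes v: "convex_lift n v" and n: "n \<ge> 3"
  shows "br (v i) (v (i + 1)) (v k) \<ge> 0"
proof -
  from convex_lift_periodic[OF v, of "i + (k - i) mod n" "(k - i) div n"] have k: "v k = v (i + (k - i) mod n)"
    by (simp add: add.assoc)
  have m: "0 \<le> (k - i) mod n" "(k - i) mod n < n" using n by simp_all
  show ?thesis
  proof (cases "(k - i) mod n = 0")
    case False
    then show ?thesis unfolding k using m n by (intro convex_lift_nonneg[OF v]) linarith+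
  qed (simp add: k)
qed

text \<open>Index \<open>i\<close> belongs to the edge from \<open>v i\<close> to
  \<open>v (i + 1)\<close>, in agreement with the positions used by \<open>heat_map\<close>.\<close>

definition heat_lift :: "real \<Rightarrow> (int \<Rightarrow> real^3) \<Rightarrow> int \<Rightarrow> real^3" where
  "heat_lift lam v i = heat_vec lam (v (i - 1)) (v i) (v (i + 1)) (v (i + 2))"

lemma convex_lift_heat_lift:
  assumes v: "convex_lift n v" and n: "n \<ge> 5" and lam: "lam > 0"
  shows "convex_lift n (heat_lift lam v)"
proof -
  note per = v[unfolded convex_lift_def, THEN conjunct1, rule_format]
  note pos = convex_lift_pos[OF v] and nonneg = convex_lift_nonneg[OF v]
  let ?w = "heat_lift lam v"
  let ?e = "\<lambda>i. outer (v (i - 1)) (v i) (v (i + 1)) (v (i + 2))"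
  have wper: "?w (i + n) = ?w i" for i
    using per[of "i - 1"] per[of i] per[of "i + 1"] per[of "i + 2"]
    by (simp add: heat_lift_def algebra_simps)

  \<comment> \<open>All four vertices defining the heat vertex \<open>k\<close> lie on the arc from
    \<open>q\<close> round to \<open>p + n\<close>, ends allowed. Strictness comes from
    \<open>v (k + 1)\<close>, which is interior to the arc.\<close>
  have diag: "br (v p) (v q) (?w k) > 0" if "p < q" "q \<le> k - 1" "k + 2 \<le> p + n" for p q k
  proof -
    have "br (v p) (v q) (?e k) \<ge> 0"
      using that by (intro br_outer_nonneg pos nonneg) simp_all
    moreover have "br (v p) (v q) (v (k - 1)) \<ge> 0" "br (v p) (v q) (v (k + 1)) > 0"
      "br (v k) (v (k + 1)) (v (k + 2)) > 0" "br (v (k - 1)) (v k) (v (k + 2)) > 0"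
      using that n by (auto intro!: nonneg pos)
    ultimately show ?thesis
      using lam unfolding heat_lift_def heat_vec_def br_lin3
      by (intro add_nonneg_pos add_pos_nonneg mult_pos_pos mult_nonneg_nonneg) auto
  qed
  have diag': "br (v i) (v (i + 2)) (?w k) > 0" if "i + 2 \<le> k" "k \<le> i + n - 2" for i k
  proof (cases "k = i + 2")
    case False
    then show ?thesis using that n by (intro diag) auto
  next
    case True
    \<comment> \<open>Now \<open>v (k - 1)\<close> lies on the wrong side of the line. In the form
      \<open>heat_vec_alt\<close> it enters only through the outer vector, with a negative
      coefficient, while \<open>v k\<close> lies on the line.\<close>
    have "br (v i) (v (i + 2)) (v (i + 1)) < 0"
      using pos[of i "i + 1" "i + 2"] n br_swap[of "v i" "v (i + 2)" "v (i + 1)"] by simp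
    moreover have "br (v (i + 2)) (v (i + 3)) (v (i + 4)) > 0" using n by (intro pos) auto
    ultimately have "br (v i) (v (i + 2)) (?e k) > 0"
      using mult_pos_neg True by (fastforce simp: outer_def br_lin3 ac_simps)
    moreover have "br (v i) (v (i + 2)) (v (i + 4)) * br (v (i + 1)) (v (i + 2)) (v (i + 3)) > 0"
      using n by (intro mult_pos_pos pos) auto
    ultimately show ?thesis
      using lam True
      by (auto simp: heat_lift_def heat_vec_alt br_lin3 mult.commute add.commute intro!: add_pos_pos)
  qed
  have after: "br (v (i + 1)) (v (i + 2)) (?w k) \<ge> 0" if "i + 2 \<le> k" "k \<le> i + n - 2" for i k
  proof (cases "k = i + 2")
    case False
    then show ?thesis using that n by (intro less_imp_le[OF diag]) auto
  next
    case True
    \<comment> \<open>The line is now the first side in the construction of the heat vertex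
      \<open>k\<close>, so the outer vector lies on it and drops out.\<close>
    then have k: "v (i + 1) = v (k - 1)" "v (i + 2) = v k" by (simp_all add: algebra_simps)
    have "br (v (k - 1)) (v k) (v (k + 1)) \<ge> 0" "br (v (k - 1)) (v k) (v (k + 2)) \<ge> 0"
      using n by (auto intro!: nonneg)
    then show ?thesis by (simp add: heat_lift_def heat_vec_def outer_def br_lin3 k)
  qed
  have before: "br (v (i - 1)) (v i) (?w k) \<ge> 0" if "i + 2 \<le> k" "k \<le> i + n - 2" for i k
  proof (cases "k = i + n - 2")
    case False
    then show ?thesis using that n by (intro less_imp_le[OF diag]) auto
  next
    case True
    \<comment> \<open>By periodicity the line is now the last side in the construction of the heat
      vertex \<open>k\<close>, and the outer vector again drops out.\<close>
    then have "k + 1 = i - 1 + n" "k + 2 = i + n" by simp_all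
    then have k: "v (k + 1) = v (i - 1)" "v (k + 2) = v i" by (simp_all only: per)
    have "br (v (i - 1)) (v i) (v (k - 1)) \<ge> 0" "br (v (i - 1)) (v i) (v k) \<ge> 0"
      using True n by (auto intro!: nonneg)
    moreover have "br (v (k - 1)) (v k) (v (k + 2)) \<ge> 0" "br (v k) (v (k + 1)) (v (k + 2)) \<ge> 0"
      using n by (auto intro!: nonneg)
    ultimately show ?thesis
      by (simp add: heat_lift_def heat_vec_def outer_alt br_lin3 k)
  qed

  have far: "br (?w i) (?w (i + 1)) (?w k) > 0" if k: "i + 2 \<le> k" "k \<le> i + n - 2" for i k
  proof -
    let ?a = "v (i - 1)" and ?b = "v i" and ?c = "v (i + 1)" and ?d = "v (i + 2)"
    let ?L = "br (?w i) (?w (i + 1))"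
    have w1: "?w (i + 1) = heat_vec lam ?b ?c ?d (v (i + 3))" by (simp add: heat_lift_def add.commute)
    have Lb: "?L ?b > 0" and Ld: "?L ?d > 0" and Le: "?L (?e i) < 0"
      unfolding w1 unfolding heat_lift_def using lam n
      by (auto intro!: heat_edge_left heat_edge_right heat_edge_outer pos)
    have abc: "br ?a ?b ?c > 0" "br ?a ?b ?d > 0" "br ?b ?c ?d > 0" using n by (auto intro!: pos)
    \<comment> \<open>Cramer's rule in the basis \<open>?b\<close>, \<open>?d\<close>,
      \<open>?e i\<close>, whose determinant is negative. The next two identities turn the
      coefficients of \<open>?b\<close> and \<open>?d\<close> into positions relative to the lines
      \<open>cd\<close> and \<open>ab\<close>.\<close>
    have D: "br ?b ?d (?e i) = - (br ?a ?b ?d * br ?b ?c ?d)"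
      by (simp add: outer_alt br_lin3 br_swap[of ?b ?d ?c])
    have "br (?w k) ?d (?e i) = - (br ?a ?b ?d * br ?c ?d (?w k))"
      by (simp add: outer_alt br_lin3) (simp add: br_def algebra_simps)
    moreover have "br ?b (?w k) (?e i) = - (br ?b ?c ?d * br ?a ?b (?w k))"
      by (simp add: outer_def br_lin3) (simp add: br_def algebra_simps)
    ultimately have "br ?a ?b ?d * br ?b ?c ?d * ?L (?w k) = br ?a ?b ?d * br ?c ?d (?w k) * ?L ?b
       + br ?b ?c ?d * br ?a ?b (?w k) * ?L ?d - br ?b ?d (?w k) * ?L (?e i)"
      using br_cramer[of ?b ?d "?e i" "?w i" "?w (i + 1)" "?w k"] unfolding D by simp
    moreover have "br ?a ?b ?d * br ?c ?d (?w k) * ?L ?b \<ge> 0" "br ?b ?c ?d * br ?a ?b (?w k) * ?L ?d \<ge> 0"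
      "br ?b ?d (?w k) * ?L (?e i) < 0"
      using abc Lb Ld Le after[OF k] before[OF k] diag'[OF k]
      by (auto intro!: mult_nonneg_nonneg mult_pos_neg)
    ultimately have "br ?a ?b ?d * br ?b ?c ?d * ?L (?w k) > 0" by linarith
    then show ?thesis using mult_pos_pos[OF abc(2,3)] by (rule zero_less_mult_pos)
  qed
  have "br (?w i) (?w (i + 1)) (?w j) > 0" if "i + 1 < j" "j < i + n" for i j
  proof (cases "j = i + n - 1")
    case False
    then show ?thesis using that by (intro far) auto
  next
    case True
    then have "j = i - 1 + n" by simp
    then have "?w j = ?w (i - 1)" by (simp only: wper)
    then show ?thesis
      using far[of "i - 1" "i + 1"] n by (simp add: br_cycle[of "?w (i - 1)"])
  qed
  then show ?thesis using wper by (simp add: convex_lift_def)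
qed

subsection \<open>The projective plane\<close>

text \<open>The point with homogeneous coordinates \<open>v\<close>. The zero vector spans no
  element of \<open>rp2\<close>, hence the side conditions \<open>v \<noteq> 0\<close>.\<close>

definition pt :: "real^3 \<Rightarrow> rp2" where
  "pt v = Abs_rp2 (span {v})"

lemma Rep_pt: "v \<noteq> 0 \<Longrightarrow> Rep_rp2 (pt v) = span {v}"
  by (simp add: pt_def Abs_rp2_inverse subspace_span)

lemma pt_cases:
  obtains v where "v \<noteq> 0" "p = pt v"
proof -
  have L: "subspace (Rep_rp2 p)" "dim (Rep_rp2 p) = 1" using Rep_rp2[of p] by auto
  obtain B where B: "independent B" "Rep_rp2 p \<subseteq> span B" "card B = 1" "B \<subseteq> Rep_rp2 p"
    using basis_exists[of "Rep_rp2 p"] L(2) by metis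
  then obtain v where v: "B = {v}" by (auto simp: card_1_singleton_iff)
  then have "Rep_rp2 p = span {v}"
    using B L(1) span_minimal[of B "Rep_rp2 p"] by auto
  then have "p = pt v" by (metis Rep_rp2_inverse pt_def)
  then show ?thesis using that B(1) v by (auto simp: dependent_zero)
qed

lemma pt_scaleR: "c \<noteq> 0 \<Longrightarrow> pt (c *\<^sub>R v) = pt v"
  using span_image_scale[of "{v}" "\<lambda>_. c"] by (simp add: pt_def)

lemma pt_eqE:
  assumes "pt v = pt w" "v \<noteq> 0" "w \<noteq> 0"
  obtains c where "c \<noteq> 0" "v = c *\<^sub>R w"
proof -
  have "span {v} = span {w}" using assms Rep_pt by metis
  then have "v \<in> span {w}" using span_base[of v "{v}"] by simp
  then obtain c where "v = c *\<^sub>R w" by (auto simp: span_singleton)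
  then show ?thesis using that assms(2) by auto
qed

lemma aff_pt: "aff x = pt (vector [x $ 1, x $ 2, 1])"
  by (simp add: aff_def pt_def)

lemma affine_vector_nonzero: "vector [x, y, 1 :: real] \<noteq> (0 :: real^3)"
  by (metis vector_3(3) zero_index zero_neq_one)

lemma invertible_inverseE:
  fixes M :: "real^3^3"
  assumes "invertible M"
  obtains N where "invertible N" "N ** M = mat 1"
  using assms unfolding invertible_def by blast

lemma invertible_mult_nonzero:
  fixes M :: "real^3^3"
  assumes "invertible M" "v \<noteq> 0"
  shows "M *v v \<noteq> 0"
proof
  assume "M *v v = 0"
  obtain N where "N ** M = mat 1" using invertible_inverseE[OF assms(1)] .
  then have "v = N *v (M *v v)" by (simp add: matrix_vector_mul_assoc)
  then show False using \<open>M *v v = 0\<close> assms(2) by simp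
qed

lemma proj_map_pt: "v \<noteq> 0 \<Longrightarrow> proj_map M (pt v) = pt (M *v v)"
  using linear_span_image[of "(*v) M" "{v}"] by (simp add: proj_map_def Rep_pt) (simp add: pt_def)

lemma proj_map_comp:
  assumes "invertible N"
  shows "proj_map M (proj_map N p) = proj_map (M ** N) p"
proof -
  obtain v where v: "v \<noteq> 0" "p = pt v" by (rule pt_cases)
  then show ?thesis using invertible_mult_nonzero[OF assms v(1)]
    by (simp add: proj_map_pt matrix_vector_mul_assoc)
qed

lemma proj_map_mat_1: "proj_map (mat 1) p = p"
  by (simp add: proj_map_def Rep_rp2_inverse)

lemma PGL3_inverse:
  assumes "T \<in> PGL3"
  obtains S where "S \<in> PGL3" "\<And>p. S (T p) = p"
proof -
  obtain M where M: "invertible M" "T = proj_map M" using assms by (auto simp: PGL3_def)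
  obtain N where "invertible N" "N ** M = mat 1" using invertible_inverseE[OF M(1)] .
  then show ?thesis using that[of "proj_map N"] M
    by (auto simp: PGL3_def proj_map_comp proj_map_mat_1)
qed

lemma PGL3_comp: "S \<in> PGL3 \<Longrightarrow> T \<in> PGL3 \<Longrightarrow> S \<circ> T \<in> PGL3"
  unfolding PGL3_def using invertible_mult by (fastforce simp: proj_map_comp)

lemma id_PGL3: "id \<in> PGL3"
proof -
  have "id = proj_map (mat 1)" by (simp add: fun_eq_iff proj_map_mat_1)
  moreover have "invertible (mat 1 :: real^3^3)" unfolding invertible_def by (metis matrix_mul_lid)
  ultimately show ?thesis unfolding PGL3_def by blast
qed

text \<open>Right translation by \<open>T\<close> permutes the group, so both lists have the same
  orbit.\<close>

lemma proj_equiv_class_map: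
  assumes "T \<in> PGL3"
  shows "proj_equiv `` {map T A} = proj_equiv `` {A}"
proof -
  obtain S where S: "S \<in> PGL3" "\<And>p. S (T p) = p" using PGL3_inverse[OF assms] by blast
  have "{map U (map T A) | U. U \<in> PGL3} = {map U A | U. U \<in> PGL3}" (is "?L = ?R")
  proof
    show "?L \<subseteq> ?R"
    proof
      fix B assume "B \<in> ?L"
      then obtain U where U: "U \<in> PGL3" "B = map U (map T A)" by blast
      then have "B = map (U \<circ> T) A" by simp
      then show "B \<in> ?R" using PGL3_comp[OF U(1) assms] by blast
    qed
    show "?R \<subseteq> ?L"
    proof
      fix B assume "B \<in> ?R"
      then obtain U where U: "U \<in> PGL3" "B = map U A" by blast
      then have "B = map (U \<circ> S) (map T A)" using S(2) by simp
      then show "B \<in> ?L" using PGL3_comp[OF U(1) S(1)] by blast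
    qed
  qed
  moreover have "proj_equiv `` {B} = {map U B | U. U \<in> PGL3}" for B
    by (auto simp: proj_equiv_def)
  ultimately show ?thesis by simp
qed

section \<open>Projective frames and the normalization to the square\<close>

lemma br_matrix: "br (M *v x) (M *v y) (M *v z) = det M * br x y z"
  by (simp add: br_def det_3 matrix_vector_mult_def sum_3 algebra_simps)

lemma br_nonzeroD:
  assumes "br x y z \<noteq> 0"
  shows "x \<noteq> 0" "y \<noteq> 0" "z \<noteq> 0"
  using assms by (auto simp: br_def)

lemma br_expand:
  "br a b c *\<^sub>R x = br x b c *\<^sub>R a + br a x c *\<^sub>R b + br a b x *\<^sub>R c"
  by (simp add: br_def vec_eq_iff forall_3 algebra_simps)

text \<open>The map is Cramer's coordinates in the first basis, recombined with the second; it is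
  invertible because the image bracket does not vanish.\<close>

lemma exists_matrix_frame:
  assumes D: "br a b c \<noteq> 0" and D': "br a' b' c' \<noteq> 0"
  obtains M where "invertible M" "M *v a = a'" "M *v b = b'" "M *v c = c'"
proof -
  define f where "f x = (br x b c / br a b c) *\<^sub>R a' + (br a x c / br a b c) *\<^sub>R b'
    + (br a b x / br a b c) *\<^sub>R c'" for x
  have "br (x + y) b c = br x b c + br y b c" "br a (x + y) c = br a x c + br a y c" for x y
    by (simp_all add: br_def algebra_simps)
  then have "linear f"
    by (intro linearI)
      (simp_all add: f_def br_lin3 br_scale add_divide_distrib scaleR_add_left scaleR_add_right)
  then have f: "matrix f *v x = f x" for x by (simp add: matrix_works)
  have M: "matrix f *v a = a'" "matrix f *v b = b'" "matrix f *v c = c'"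
    using D by (simp_all add: f f_def)
  then have "det (matrix f) \<noteq> 0" using br_matrix[of "matrix f" a b c] D' by auto
  then show ?thesis using that M by (simp add: invertible_det_nz)
qed

lemma matrix_frame_unique:
  assumes D: "br a b c \<noteq> 0"
    and "M *v a = r *\<^sub>R (N *v a)" "M *v b = r *\<^sub>R (N *v b)" "M *v c = r *\<^sub>R (N *v c)"
  shows "M *v x = r *\<^sub>R (N *v x)"
proof -
  obtain p q s where x: "br a b c *\<^sub>R x = p *\<^sub>R a + q *\<^sub>R b + s *\<^sub>R c"
    using br_expand by blast
  have "M *v (br a b c *\<^sub>R x) = r *\<^sub>R (N *v (br a b c *\<^sub>R x))"
    unfolding x matrix_vector_right_distrib matrix_vector_mult_scaleR assms(2-4)
    by (simp add: scaleR_add_right mult.commute)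
  then have "br a b c *\<^sub>R (M *v x) = br a b c *\<^sub>R (r *\<^sub>R (N *v x))"
    by (simp add: matrix_vector_mult_scaleR mult.commute)
  then show ?thesis using D by (rule scaleR_left_imp_eq[rotated])
qed

text \<open>The rescaled vectors and the lifted corners of the square satisfy the same relation,
  \<open>a' + c' = b' + d'\<close>. A matrix matching three of them therefore matches the
  fourth.\<close>

lemma heat_point_pt:
  assumes pos: "br a b c \<noteq> 0" "br a b d \<noteq> 0" "br a c d \<noteq> 0" "br b c d \<noteq> 0"
  shows "heat_point lam (pt a) (pt b) (pt c) (pt d) = pt (heat_vec lam a b c d)"
proof -
  let ?A = "vector [-1, 1, 1] :: real^3" and ?B = "vector [1, 1, 1] :: real^3"
    and ?C = "vector [1, -1, 1] :: real^3" and ?D = "vector [-1, -1, 1] :: real^3"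
  define a' where "a' = br b c d *\<^sub>R a"
  define b' where "b' = br a c d *\<^sub>R b"
  define c' where "c' = br a b d *\<^sub>R c"
  define d' where "d' = br a b c *\<^sub>R d"
  have sq: "aff (vector [-1, 1]) = pt ?A" "aff (vector [1, 1]) = pt ?B"
    "aff (vector [1, -1]) = pt ?C" "aff (vector [-1, -1]) = pt ?D"
    by (simp_all add: aff_pt)
  have sq0: "?A \<noteq> 0" "?B \<noteq> 0" "?C \<noteq> 0" "?D \<noteq> 0" by (simp_all add: affine_vector_nonzero)
  have abcd: "a \<noteq> 0" "b \<noteq> 0" "c \<noteq> 0" "d \<noteq> 0" using pos br_nonzeroD by blast+
  have pts: "pt a = pt a'" "pt b = pt b'" "pt c = pt c'" "pt d = pt d'"
    using pos by (simp_all add: a'_def b'_def c'_def d'_def pt_scaleR)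
  have nz: "a' \<noteq> 0" "b' \<noteq> 0" "c' \<noteq> 0" "d' \<noteq> 0"
    using pos abcd by (simp_all add: a'_def b'_def c'_def d'_def)
  have rel: "a' + c' = b' + d'"
    unfolding a'_def b'_def c'_def d'_def by (rule br_relation)
  have brABC: "br ?A ?B ?C \<noteq> 0" by (simp add: br_def)
  have br': "br a' b' c' \<noteq> 0" using pos by (simp add: a'_def b'_def c'_def br_scale)
  obtain M where M: "invertible M" "M *v a' = ?A" "M *v b' = ?B" "M *v c' = ?C"
    using exists_matrix_frame[OF br' brABC] .
  have d'_eq: "d' = a' + c' - b'" using rel by simp
  have Md: "M *v d' = ?D"
    unfolding d'_eq by (simp add: matrix_vector_mult_diff_distrib matrix_vector_right_distrib M
        vec_eq_iff forall_3)
  have "to_square (pt a) (pt b) (pt c) (pt d) = proj_map M"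
    unfolding to_square_def sq
  proof (rule the_equality)
    show "proj_map M \<in> PGL3 \<and> proj_map M (pt a) = pt ?A \<and> proj_map M (pt b) = pt ?B \<and>
      proj_map M (pt c) = pt ?C \<and> proj_map M (pt d) = pt ?D"
      using M Md nz by (auto simp: pts proj_map_pt PGL3_def)
  next
    fix T assume T: "T \<in> PGL3 \<and> T (pt a) = pt ?A \<and> T (pt b) = pt ?B \<and>
      T (pt c) = pt ?C \<and> T (pt d) = pt ?D"
    then obtain N where N: "invertible N" "T = proj_map N" by (auto simp: PGL3_def)
    have "pt (N *v a') = pt ?A" "pt (N *v b') = pt ?B" "pt (N *v c') = pt ?C" "pt (N *v d') = pt ?D"
      using T nz N by (simp_all add: pts proj_map_pt)
    note eqs = this and nzN = nz[THEN invertible_mult_nonzero[OF N(1)]]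
    obtain r where "r \<noteq> 0" and Na: "N *v a' = r *\<^sub>R ?A"
      using pt_eqE[OF eqs(1) nzN(1) sq0(1)] .
    obtain s where Nb: "N *v b' = s *\<^sub>R ?B" using pt_eqE[OF eqs(2) nzN(2) sq0(2)] .
    obtain t where Nc: "N *v c' = t *\<^sub>R ?C" using pt_eqE[OF eqs(3) nzN(3) sq0(3)] .
    obtain u where Nd: "N *v d' = u *\<^sub>R ?D" using pt_eqE[OF eqs(4) nzN(4) sq0(4)] .
    \<comment> \<open>A competitor fixes each corner only up to a factor; the relation among the
      corners forces the factors to agree, so it is the same projective map.\<close>
    have "r *\<^sub>R ?A + t *\<^sub>R ?C = s *\<^sub>R ?B + u *\<^sub>R ?D"
      using arg_cong[OF rel, of "(*v) N"] by (simp add: matrix_vector_right_distrib Na Nb Nc Nd)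
    then have "t - r = s - u" "r - t = s - u" "r + t = s + u"
      by (simp_all add: vec_eq_iff forall_3)
    then have "t = r" "s = r" by linarith+
    then have "N *v x = r *\<^sub>R (M *v x)" for x
      using matrix_frame_unique[OF br', of N r M x] by (simp add: Na Nb Nc M)
    show "T = proj_map M"
    proof
      fix p
      obtain v where "v \<noteq> 0" "p = pt v" by (rule pt_cases)
      then show "T p = proj_map M p"
        using \<open>\<And>x. N *v x = r *\<^sub>R (M *v x)\<close> \<open>r \<noteq> 0\<close> by (simp add: N(2) proj_map_pt pt_scaleR)
    qed
  qed
  moreover have w: "heat_vec lam a b c d = a' + c' + lam *\<^sub>R (b' - a')"
    by (simp add: heat_vec_def outer_def a'_def b'_def c'_def)
  have "M *v heat_vec lam a b c d = 2 *\<^sub>R vector [lam, 0, 1]"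
    unfolding w by (simp add: matrix_vector_mult_diff_distrib matrix_vector_right_distrib
        matrix_vector_mult_scaleR M vec_eq_iff forall_3)
  moreover from this have "heat_vec lam a b c d \<noteq> 0"
    using affine_vector_nonzero[of lam 0] by (auto simp: matrix_vector_mult_0_right)
  ultimately have "to_square (pt a) (pt b) (pt c) (pt d) (pt (heat_vec lam a b c d)) = aff (vector [lam, 0])"
    by (simp add: proj_map_pt aff_pt pt_scaleR)
  moreover have "inj (proj_map M)"
    using PGL3_inverse[of "proj_map M"] M(1) by (metis (mono_tags, lifting) PGL3_def injI mem_Collect_eq)
  ultimately show ?thesis
    unfolding heat_point_def \<open>to_square (pt a) (pt b) (pt c) (pt d) = proj_map M\<close>
    by (intro inv_f_eq) simp_all
qed

subsection \<open>Strictly convex polygons\<close>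

definition homog :: "real^2 \<Rightarrow> real^3" where
  "homog x = vector [x $ 1, x $ 2, 1]"

lemma br_homog:
  "br (homog x) (homog y) (homog z) = (y$1 - x$1) * (z$2 - x$2) - (y$2 - x$2) * (z$1 - x$1)"
  by (simp add: br_def homog_def algebra_simps)

text \<open>Both sides are affine functions of \<open>z\<close> vanishing on the line through
  \<open>x\<close> and \<open>y\<close>, hence proportional. The factor is nonzero by Lagrange's
  identity \<open>t2\<close>, as \<open>a\<close> is orthogonal to \<open>y - x\<close>.\<close>

lemma br_homog_hyperplane:
  assumes "a \<bullet> x = b" "a \<bullet> y = b" "x \<noteq> y" "a \<noteq> 0"
  obtains \<mu> where "\<mu> \<noteq> 0" "\<And>z. br (homog x) (homog y) (homog z) = \<mu> * (b - a \<bullet> z)"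
proof
  define N where "N = (a$1)^2 + (a$2)^2"
  define t where "t = a$1 * (y$2 - x$2) - a$2 * (y$1 - x$1)"
  have N: "N > 0" using assms(4) by (auto simp: N_def vec_eq_iff forall_2 sum_power2_gt_zero_iff)
  have b: "b = a$1 * x$1 + a$2 * x$2" using assms(1) by (simp add: inner_vec_def sum_2)
  have orth: "a$1 * (y$1 - x$1) + a$2 * (y$2 - x$2) = 0"
    using assms(2) b by (simp add: inner_vec_def sum_2 algebra_simps)
  have t2: "t^2 + (a$1 * (y$1 - x$1) + a$2 * (y$2 - x$2))^2 = N * ((y$1 - x$1)^2 + (y$2 - x$2)^2)"
    by (simp add: t_def N_def power2_eq_square algebra_simps)
  have "(y$1 - x$1)^2 + (y$2 - x$2)^2 > 0"
    using assms(3) by (auto simp: vec_eq_iff forall_2 sum_power2_gt_zero_iff)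
  then show "t / N \<noteq> 0" using t2 N orth by auto
  fix z
  have "N * br (homog x) (homog y) (homog z) - t * (b - a \<bullet> z)
    = (a$1 * (y$1 - x$1) + a$2 * (y$2 - x$2)) * (a$1 * (z$2 - x$2) - a$2 * (z$1 - x$1))"
    by (simp add: br_homog b N_def t_def inner_vec_def sum_2 power2_eq_square algebra_simps)
  then have "N * br (homog x) (homog y) (homog z) = t * (b - a \<bullet> z)"
    unfolding orth by simp
  then show "br (homog x) (homog y) (homog z) = t / N * (b - a \<bullet> z)"
    using N by (simp add: eq_divide_eq mult.commute)
qed

text \<open>An edge of a polytope is exposed by a supporting line. A further vertex on that line
  would be an extreme point of the edge, hence one of its ends. The sign of \<open>s\<close> is
  still free to depend on the edge.\<close>

lemma strictly_convex_polygon_side: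
  assumes xs: "strictly_convex_polygon xs" and i: "i < length xs"
  obtains s where "s \<noteq> 0" "\<And>k. k < length xs \<Longrightarrow> k \<noteq> i \<Longrightarrow> k \<noteq> Suc i mod length xs \<Longrightarrow>
    s * br (homog (xs ! i)) (homog (xs ! (Suc i mod length xs))) (homog (xs ! k)) > 0"
proof -
  let ?n = "length xs" and ?H = "convex hull (set xs)"
  let ?j = "Suc i mod ?n"
  let ?x = "xs ! i" and ?y = "xs ! ?j"
  have n: "3 \<le> ?n" and dist: "distinct xs" and ext: "{x. x extreme_point_of ?H} = set xs"
    and edge: "closed_segment ?x ?y edge_of ?H"
    using xs i unfolding strictly_convex_polygon_def by blast+
  have j: "?j < ?n" "?j \<noteq> i" using n i by (auto simp: mod_Suc)
  have face: "closed_segment ?x ?y face_of ?H" using edge by (simp add: edge_of_def)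
  then have "closed_segment ?x ?y exposed_face_of ?H"
    by (simp add: exposed_face_of_polyhedron polyhedron_convex_hull)
  then obtain a b where ab: "?H \<subseteq> {x. a \<bullet> x \<le> b}" "closed_segment ?x ?y = ?H \<inter> {x. a \<bullet> x = b}"
    unfolding exposed_face_of_def by blast
  have xy: "a \<bullet> ?x = b" "a \<bullet> ?y = b" using ab(2) ends_in_segment[of ?x ?y] by blast+
  have neq: "?x \<noteq> ?y" using dist i j by (simp add: nth_eq_iff_index_eq)
  have strict: "a \<bullet> (xs ! k) < b" if k: "k < ?n" "k \<noteq> i" "k \<noteq> ?j" for k
  proof (rule ccontr)
    assume "\<not> a \<bullet> (xs ! k) < b"
    moreover have "xs ! k \<in> ?H" using k(1) by (simp add: hull_inc)
    ultimately have "xs ! k \<in> closed_segment ?x ?y" using ab by force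
    moreover have "xs ! k extreme_point_of ?H" using ext k(1) nth_mem by blast
    ultimately have "xs ! k extreme_point_of closed_segment ?x ?y"
      using extreme_point_of_face[OF face] by blast
    then have "xs ! k = ?x \<or> xs ! k = ?y" by (simp add: extreme_point_of_segment)
    then show False using dist k i j by (simp add: nth_eq_iff_index_eq)
  qed
  show ?thesis
  proof (cases "a = 0")
    \<comment> \<open>The supporting functional may be zero a priori; then \<open>strict\<close>
      leaves no further vertex and the claim is vacuous.\<close>
    case True
    then have "\<not> a \<bullet> (xs ! k) < b" for k using xy(1) by simp
    then show ?thesis using that[of 1] strict by auto
  next
    case False
    obtain \<mu> where \<mu>: "\<mu> \<noteq> 0" "\<And>z. br (homog ?x) (homog ?y) (homog z) = \<mu> * (b - a \<bullet> z)"
      using br_homog_hyperplane[OF xy neq False] by blast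
    show ?thesis
    proof (rule that[of \<mu>])
      fix k assume "k < ?n" "k \<noteq> i" "k \<noteq> ?j"
      moreover have "\<mu> * \<mu> > 0" using \<mu>(1) not_real_square_gt_zero by blast
      ultimately have "(\<mu> * \<mu>) * (b - a \<bullet> (xs ! k)) > 0" using strict by simp
      then show "\<mu> * br (homog ?x) (homog ?y) (homog (xs ! k)) > 0" by (simp add: \<mu>(2) mult.assoc)
    qed (rule \<mu>(1))
  qed
qed

lemma br_homog_affine:
  obtains a b where "\<And>z. c * br (homog x) (homog y) (homog z) = a \<bullet> z - b"
proof
  fix z
  show "c * br (homog x) (homog y) (homog z)
    = vector [c * (x$2 - y$2), c * (y$1 - x$1)] \<bullet> z - c * ((y$1 - x$1) * x$2 - (y$2 - x$2) * x$1)"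
    by (simp add: br_homog inner_vec_def sum_2 algebra_simps)
qed

text \<open>The remaining vertices lie strictly on one side of each edge line, so the edge is a
  face; every vertex is extreme as an end of such a face. The common factor \<open>c\<close> admits
  either orientation.\<close>

lemma strictly_convex_polygonI:
  assumes n: "3 \<le> length xs"
    and pos: "\<And>i k. i < length xs \<Longrightarrow> k < length xs \<Longrightarrow> k \<noteq> i \<Longrightarrow> k \<noteq> Suc i mod length xs \<Longrightarrow>
      c * br (homog (xs ! i)) (homog (xs ! (Suc i mod length xs))) (homog (xs ! k)) > 0"
  shows "strictly_convex_polygon xs"
proof -
  let ?n = "length xs" and ?H = "convex hull (set xs)"
  have neq: "xs ! i \<noteq> xs ! k" if "i < ?n" "k < ?n" "k \<noteq> i" for i k
  proof (cases "k = Suc i mod ?n")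
    case False
    then show ?thesis using pos[of i k] that by auto
  next
    case True
    \<comment> \<open>With at least three vertices two indices cannot succeed each other both ways,
      so one of the two edges separates the points.\<close>
    then have "i \<noteq> Suc k mod ?n" using that n by (auto simp: mod_Suc split: if_splits)
    then show ?thesis using pos[of k i] that by auto
  qed
  then have dist: "distinct xs" by (metis distinct_conv_nth)
  have face: "closed_segment (xs ! i) (xs ! (Suc i mod ?n)) face_of ?H" if i: "i < ?n" for i
  proof -
    let ?x = "xs ! i" and ?y = "xs ! (Suc i mod ?n)"
    obtain a b where ab: "\<And>z. c * br (homog ?x) (homog ?y) (homog z) = a \<bullet> z - b"
      using br_homog_affine by blast
    have "a \<bullet> ?x = b" "a \<bullet> ?y = b" using ab[of ?x] ab[of ?y] by simp_all
    then have 1: "affine hull {?x, ?y} \<subseteq> {z. a \<bullet> z = b}"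
      by (intro hull_minimal) (auto simp: affine_hyperplane)
    have "z \<in> {z. a \<bullet> z > b}" if "z \<in> set xs - {?x, ?y}" for z
    proof -
      obtain k where "k < ?n" "z = xs ! k" using \<open>z \<in> _\<close> by (auto simp: in_set_conv_nth)
      then show ?thesis using pos[OF i, of k] ab[of z] that by force
    qed
    then have "convex hull (set xs - {?x, ?y}) \<subseteq> {z. a \<bullet> z > b}"
      by (intro hull_minimal) (auto simp: convex_halfspace_gt)
    with 1 have disj: "affine hull {?x, ?y} \<inter> convex hull (set xs - {?x, ?y}) = {}" by fastforce
    have "Suc i mod ?n < ?n" using n by (intro mod_less_divisor) linarith
    then have "{?x, ?y} \<subseteq> set xs" using i by simp
    then show ?thesis
      using face_of_convex_hulls[OF _ _ disj] by (simp add: segment_convex_hull)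
  qed
  have "{x. x extreme_point_of ?H} = set xs"
  proof
    show "set xs \<subseteq> {x. x extreme_point_of ?H}"
    proof
      fix z assume "z \<in> set xs"
      then obtain i where "i < ?n" "z = xs ! i" by (auto simp: in_set_conv_nth)
      then show "z \<in> {x. x extreme_point_of ?H}"
        using extreme_point_of_face[OF face[of i], of z] by (simp add: extreme_point_of_segment)
    qed
  qed (rule extreme_points_of_convex_hull)
  moreover have "closed_segment (xs ! i) (xs ! (Suc i mod ?n)) edge_of ?H" if "i < ?n" for i
  proof -
    have "Suc i mod ?n < ?n" "Suc i mod ?n \<noteq> i" using n that by (auto simp: mod_Suc)
    then have "xs ! i \<noteq> xs ! (Suc i mod ?n)" using neq that by blast
    then show ?thesis
      using face[OF that] by (simp add: edge_of_def segment_convex_hull aff_dim_convex_hull)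
  qed
  ultimately show ?thesis using n dist by (simp add: strictly_convex_polygon_def)
qed

subsection \<open>Convex polygons and their lifts\<close>

lemma nat_mod_less: "n > 0 \<Longrightarrow> nat (i mod int n) < n"
  by (simp add: nat_less_iff)

lemma nat_mod_add_1:
  "n > 0 \<Longrightarrow> nat ((i + 1) mod int n) = Suc (nat (i mod int n)) mod n"
proof -
  assume "n > 0"
  then have "int (Suc (nat (i mod int n)) mod n) = (1 + i mod int n) mod int n"
    by (simp add: zmod_int)
  also have "\<dots> = (i + 1) mod int n" by (simp only: mod_add_right_eq add.commute)
  finally show ?thesis by (metis nat_int)
qed

lemma nat_mod_neq:
  assumes "i < j" "j < i + int n"
  shows "nat (j mod int n) \<noteq> nat (i mod int n)"
proof
  assume "nat (j mod int n) = nat (i mod int n)"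
  moreover have "j mod int n \<ge> 0" "i mod int n \<ge> 0" using assms by simp_all
  ultimately have "j mod int n = i mod int n" by linarith
  then have "int n dvd j - i" by (simp add: mod_eq_dvd_iff)
  then show False using zdvd_imp_le[of "int n" "j - i"] assms by simp
qed

text \<open>Adjacent edges share the triple of three consecutive vertices, so the signs belonging to
  the edges all agree.\<close>

lemma strictly_convex_polygon_orientation:
  fixes v :: "int \<Rightarrow> real^3"
  assumes xs: "strictly_convex_polygon xs"
    and v: "\<And>i. v i = homog (xs ! nat (i mod int (length xs)))"
  obtains c where "c \<noteq> 0"
    "\<And>i j. i + 1 < j \<Longrightarrow> j < i + int (length xs) \<Longrightarrow> c * br (v i) (v (i + 1)) (v j) > 0"
proof -
  let ?n = "length xs"
  have n: "?n \<ge> 3" using xs by (simp add: strictly_convex_polygon_def)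
  define \<sigma> where "\<sigma> i = br (v i) (v (i + 1)) (v (i + 2))" for i
  have \<sigma>: "\<sigma> i * br (v i) (v (i + 1)) (v j) > 0" if j: "i + 1 < j" "j < i + int ?n" for i j
  proof -
    let ?i = "nat (i mod int ?n)"
    have lt: "nat (k mod int ?n) < ?n" for k using n by (intro nat_mod_less) linarith
    have succ: "nat ((i + 1) mod int ?n) = Suc ?i mod ?n" using n by (intro nat_mod_add_1) linarith
    obtain s where s: "s \<noteq> 0" "\<And>k. k < ?n \<Longrightarrow> k \<noteq> ?i \<Longrightarrow> k \<noteq> Suc ?i mod ?n \<Longrightarrow>
        s * br (homog (xs ! ?i)) (homog (xs ! (Suc ?i mod ?n))) (homog (xs ! k)) > 0"
      using strictly_convex_polygon_side[OF xs lt] by blast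
    have "s * br (v i) (v (i + 1)) (v k) > 0" if k: "i + 1 < k" "k < i + int ?n" for k
      unfolding v succ using k nat_mod_neq[of i k ?n] nat_mod_neq[of "i + 1" k ?n] lt
      by (intro s) (simp_all add: succ)
    \<comment> \<open>Comparison with the vertex \<open>i + 2\<close> eliminates the unknown sign of
      \<open>s\<close>.\<close>
    from this[of "i + 2"] this[OF j] show ?thesis
      using n by (auto simp: \<sigma>_def zero_less_mult_iff)
  qed
  have "\<sigma> (i + 1) * \<sigma> i > 0" for i
  proof -
    have "v (i + int ?n) = v i" by (simp add: v)
    then show ?thesis
      using \<sigma>[of "i + 1" "i + int ?n"] n br_cycle[of "v i" "v (i + 1)" "v (i + 2)"]
      by (simp add: \<sigma>_def add.assoc)
  qed
  note step = this
  have \<sigma>0: "\<sigma> 0 * \<sigma> i > 0" for i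
  proof (induction i rule: int_induct[where k = 0])
    case base
    have "\<sigma> 0 \<noteq> 0" using step[of 0] by auto
    then show ?case using not_real_square_gt_zero by blast
  next
    case (step1 i)
    then show ?case using step[of i] by (auto simp: zero_less_mult_iff)
  next
    case (step2 i)
    then show ?case using step[of "i - 1"] by (auto simp: zero_less_mult_iff)
  qed
  show ?thesis
  proof (rule that)
    show "\<sigma> 0 \<noteq> 0" using \<sigma>0[of 0] by auto
    show "\<sigma> 0 * br (v i) (v (i + 1)) (v j) > 0" if "i + 1 < j" "j < i + int ?n" for i j
      using \<sigma>0[of i] \<sigma>[OF that] by (auto simp: zero_less_mult_iff)
  qed
qed

text \<open>In odd dimension, negating all vectors reverses every bracket, so either orientation
  yields a lift.\<close>

lemma convex_lift_signed:
  assumes "\<And>i. v (i + n) = v i" "c \<noteq> 0"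
    and pos: "\<And>i j. i + 1 < j \<Longrightarrow> j < i + n \<Longrightarrow> c * br (v i) (v (i + 1)) (v j) > 0"
  shows "convex_lift n v \<or> convex_lift n (\<lambda>i. - v i)"
proof -
  have neg: "br (- x) (- y) (- z) = - br x y z" for x y z by (simp add: br_def algebra_simps)
  show ?thesis
    using assms(1,2) pos unfolding convex_lift_def neg
    by (cases "c > 0") (auto simp: zero_less_mult_iff)
qed

text \<open>The homogeneous vectors of the affine polygon are pulled back by a matrix of the inverse
  transformation, which multiplies every bracket by the same determinant.\<close>

lemma convex_ngons_lift:
  assumes A: "A \<in> convex_ngons n"
  obtains v where "convex_lift (int n) v" "\<And>i. A ! nat (i mod int n) = pt (v i)"
    "n \<ge> 3" "length A = n"
proof -
  obtain T xs where len: "length A = n" and T: "T \<in> PGL3" and xs: "strictly_convex_polygon xs"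
    and TA: "map T A = map aff xs"
    using A by (auto simp: convex_ngons_def)
  have lxs: "length xs = n" using arg_cong[OF TA, of length] len by simp
  then have n: "n \<ge> 3" using xs by (simp add: strictly_convex_polygon_def)
  obtain S where S: "S \<in> PGL3" "\<And>p. S (T p) = p" using PGL3_inverse[OF T] by blast
  then obtain N where N: "invertible N" "S = proj_map N" by (auto simp: PGL3_def)
  define u where "u i = homog (xs ! nat (i mod int n))" for i
  define w where "w i = N *v u i" for i
  have Aw: "A ! nat (i mod int n) = pt (w i)" for i
  proof -
    have lt: "nat (i mod int n) < n" using n by (intro nat_mod_less) linarith
    then have "T (A ! nat (i mod int n)) = aff (xs ! nat (i mod int n))"
      using TA len lxs by (metis nth_map)
    then have "A ! nat (i mod int n) = S (aff (xs ! nat (i mod int n)))" using S(2) by metis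
    then show ?thesis
      by (simp add: N(2) aff_pt proj_map_pt affine_vector_nonzero w_def u_def homog_def)
  qed
  obtain c where c: "c \<noteq> 0"
    "\<And>i j. i + 1 < j \<Longrightarrow> j < i + int n \<Longrightarrow> c * br (u i) (u (i + 1)) (u j) > 0"
    using strictly_convex_polygon_orientation[OF xs, of u] lxs u_def by metis
  have "det N \<noteq> 0" using N(1) by (simp add: invertible_det_nz)
  have "convex_lift (int n) w \<or> convex_lift (int n) (\<lambda>i. - w i)"
  proof (rule convex_lift_signed[of w "int n" "c / det N"])
    show "w (i + int n) = w i" for i by (simp add: w_def u_def)
    show "c / det N \<noteq> 0" using c(1) \<open>det N \<noteq> 0\<close> by simp
    show "c / det N * br (w i) (w (i + 1)) (w j) > 0" if "i + 1 < j" "j < i + int n" for i j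
      using c(2)[OF that] \<open>det N \<noteq> 0\<close> by (simp add: w_def br_matrix)
  qed
  moreover have "pt (- x) = pt x" for x using pt_scaleR[of "- 1" x] by simp
  ultimately show ?thesis using that Aw n len by metis
qed

text \<open>The sum of all edge functionals is positive on every vertex. Its kernel is a line
  missing the vertices, which can be sent to infinity.\<close>

lemma convex_lift_functional:
  assumes v: "convex_lift n v" and n: "n \<ge> 3"
  obtains g where "\<And>k. g \<bullet> v k > 0"
proof -
  define f where "f x = (\<Sum>i\<in>{0..<n}. br (v i) (v (i + 1)) x)" for x
  define g :: "real^3" where "g = (\<chi> k. f (axis k 1))"
  have "br x y z = br x y (axis 1 1) * z$1 + br x y (axis 2 1) * z$2 + br x y (axis 3 1) * z$3"
    for x y z by (simp add: br_def axis_def algebra_simps)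
  then have fx: "f x = f (axis 1 1) * x$1 + f (axis 2 1) * x$2 + f (axis 3 1) * x$3" for x
    unfolding f_def sum_distrib_right sum.distrib[symmetric] by (intro sum.cong refl)
  have fg: "g \<bullet> x = f x" for x by (subst fx) (simp add: g_def inner_vec_def sum_3)
  have "f (v k) > 0" for k
  proof -
    \<comment> \<open>The edge starting just after vertex \<open>k\<close> gives a strictly positive
      summand; seen from it, \<open>v k\<close> has index \<open>?m - 1 + n\<close>.\<close>
    let ?m = "(k + 1) mod n"
    have "?m \<in> {0..<n}" using n by simp
    moreover have "br (v ?m) (v (?m + 1)) (v k) > 0"
    proof -
      have "?m - 1 + n + ((k + 1) div n - 1) * n = k"
        using div_mult_mod_eq[of "k + 1" n] unfolding left_diff_distrib by linarith
      then have "v k = v (?m - 1 + n)" using convex_lift_periodic[OF v] by metis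
      then show ?thesis using n by (simp only:) (intro convex_lift_pos[OF v], simp_all)
    qed
    ultimately show ?thesis
      unfolding f_def by (intro sum_pos2[of _ ?m]) (auto intro: convex_lift_edge_nonneg[OF v n])
  qed
  then show ?thesis using that fg by metis
qed

text \<open>Completing \<open>g\<close> by two coordinate vectors gives a projective map sending the
  line \<open>g = 0\<close> to infinity.\<close>

lemma exists_invertible_third_row:
  fixes g :: "real^3"
  assumes "g \<noteq> 0"
  obtains M :: "real^3^3" where "invertible M" "\<And>x. (M *v x) $ 3 = g \<bullet> x"
proof -
  obtain p q where pq: "br p q g \<noteq> 0"
  proof -
    have "br (axis 2 1) (axis 3 1) g = g$1" "br (axis 3 1) (axis 1 1) g = g$2" "br (axis 1 1) (axis 2 1) g = g$3"
      by (simp_all add: br_def axis_def)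
    moreover have "g$1 \<noteq> 0 \<or> g$2 \<noteq> 0 \<or> g$3 \<noteq> 0" using assms by (simp add: vec_eq_iff forall_3)
    ultimately show ?thesis using that by metis
  qed
  define M :: "real^3^3" where "M = vector [p, q, g]"
  have "det M = br p q g" by (simp add: M_def det_3 br_def algebra_simps)
  then have "invertible M" using pq by (simp add: invertible_det_nz)
  moreover have "(M *v x) $ 3 = g \<bullet> x" for x
    by (simp add: M_def matrix_vector_mult_def inner_vec_def)
  ultimately show ?thesis using that by blast
qed

text \<open>After the kernel of \<open>g\<close> is sent to infinity, dehomogenizing divides by the
  positive numbers \<open>g \<bullet> v i\<close>. All brackets keep their sign up to that of
  \<open>det M\<close>.\<close>

lemma convex_ngonsI:
  assumes v: "convex_lift (int n) v" and n: "n \<ge> 3" and len: "length A = n"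
    and A: "\<And>i. i < n \<Longrightarrow> A ! i = pt (v (int i))"
  shows "A \<in> convex_ngons n"
proof -
  obtain g where g: "\<And>k. g \<bullet> v k > 0" using convex_lift_functional[OF v] n by auto
  then have "g \<noteq> 0" by (metis inner_zero_left less_irrefl)
  then obtain M :: "real^3^3" where M: "invertible M" "\<And>x. (M *v x) $ 3 = g \<bullet> x"
    using exists_invertible_third_row by blast
  have detM: "det M \<noteq> 0" using M(1) by (simp add: invertible_det_nz)
  define y where "y i = (vector [(M *v v i) $ 1 / (g \<bullet> v i), (M *v v i) $ 2 / (g \<bullet> v i)] :: real^2)" for i
  have y: "M *v v i = (g \<bullet> v i) *\<^sub>R homog (y i)" for i
    using g[of i] by (simp add: homog_def y_def vec_eq_iff forall_3 M(2))
  define xs where "xs = map (\<lambda>i. y (int i)) [0..<n]"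
  have lxs: "length xs = n" by (simp add: xs_def)
  have v0: "v i \<noteq> 0" for i using g[of i] by auto
  have "map (proj_map M) A = map aff xs"
  proof (rule nth_equalityI)
    fix i assume "i < length (map (proj_map M) A)"
    then show "map (proj_map M) A ! i = map aff xs ! i"
      using len g[of "int i"] by (simp add: xs_def A proj_map_pt v0 y pt_scaleR aff_pt homog_def)
  qed (simp add: len lxs)
  moreover have "strictly_convex_polygon xs"
  proof (rule strictly_convex_polygonI[where c = "det M"])
    show "3 \<le> length xs" using n lxs by simp
    fix i k assume ik: "i < length xs" "k < length xs" "k \<noteq> i" "k \<noteq> Suc i mod length xs"
    have yper: "y (i + int n) = y i" for i using v by (simp add: y_def convex_lift_def)
    have "xs ! (Suc i mod n) = y (int i + 1)"
    proof (cases "Suc i = n")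
      case True
      then have "int i + 1 = 0 + int n" by simp
      then have "y (int i + 1) = y 0" by (simp only: yper)
      then show ?thesis using True n by (simp add: xs_def)
    qed (use ik lxs in \<open>simp add: xs_def add.commute\<close>)
    \<comment> \<open>The representative of \<open>k\<close> modulo \<open>n\<close> that follows
      \<open>i\<close>, as the index range of \<open>convex_lift\<close> requires.\<close>
    define j where "j = (if int k > int i then int k else int k + int n)"
    have j: "int i + 1 < j" "j < int i + int n"
      using ik lxs by (auto simp: j_def mod_Suc split: if_splits)
    have yj: "y j = y (int k)" using yper by (simp add: j_def)
    have "br (v (int i)) (v (int i + 1)) (v j) > 0" using v j by (simp add: convex_lift_def)
    then have "0 < det M * (det M * br (v (int i)) (v (int i + 1)) (v j))"
      using detM not_real_square_gt_zero[of "det M"] mult_pos_pos unfolding mult.assoc[symmetric] by blast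
    also have "\<dots> = (g \<bullet> v (int i)) * (g \<bullet> v (int i + 1)) * (g \<bullet> v j)
        * (det M * br (homog (y (int i))) (homog (y (int i + 1))) (homog (y j)))"
      unfolding br_matrix[of M "v (int i)", symmetric] y by (simp add: br_scale)
    finally have "det M * br (homog (y (int i))) (homog (y (int i + 1))) (homog (y j)) > 0"
      using g by (meson mult_pos_pos zero_less_mult_pos)
    then show "det M * br (homog (xs ! i)) (homog (xs ! (Suc i mod length xs))) (homog (xs ! k)) > 0"
      using ik \<open>xs ! (Suc i mod n) = y (int i + 1)\<close> by (simp add: yj lxs) (simp add: xs_def)
  qed
  moreover have "proj_map M \<in> PGL3" using M(1) by (auto simp: PGL3_def)
  ultimately show ?thesis using len by (auto simp: convex_ngons_def)
qed

section \<open>The heat map on lifts and its projective equivariance\<close>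

lemma heat_map_pt:
  assumes n: "n > 0" "length A = n" and A: "\<And>i. A ! nat (i mod int n) = pt (v i)"
    and br: "\<And>i. br (v (i - 1)) (v i) (v (i + 1)) \<noteq> 0" "\<And>i. br (v (i - 1)) (v i) (v (i + 2)) \<noteq> 0"
      "\<And>i. br (v (i - 1)) (v (i + 1)) (v (i + 2)) \<noteq> 0" "\<And>i. br (v i) (v (i + 1)) (v (i + 2)) \<noteq> 0"
  shows "heat_map lam A = map (\<lambda>j. pt (heat_lift lam v (int j))) [0..<n]"
proof -
  have idx: "A ! (m mod n) = pt (v (int m))" for m
    using A[of "int m"] by (simp flip: zmod_int)
  have per: "pt (v (i + int n)) = pt (v i)" for i
    using A[of "i + int n"] A[of i] by simp
  have "heat_point lam (A ! ((j + n - 1) mod n)) (A ! j) (A ! ((j + 1) mod n)) (A ! ((j + 2) mod n))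
      = pt (heat_lift lam v (int j))" if "j < n" for j
  proof -
    \<comment> \<open>Adding \<open>n\<close> first keeps the natural-number subtraction exact at
      \<open>j = 0\<close>; periodicity of the points removes it again.\<close>
    have "int (j + n - 1) = int j - 1 + int n" using n(1) by simp
    then have "A ! ((j + n - 1) mod n) = pt (v (int j - 1))" by (simp only: idx per)
    moreover have "A ! j = pt (v (int j))" using idx[of j] that by simp
    moreover have "A ! ((j + 1) mod n) = pt (v (int j + 1))" "A ! ((j + 2) mod n) = pt (v (int j + 2))"
      unfolding idx by (simp_all add: add.commute)
    ultimately show ?thesis
      unfolding heat_lift_def by (simp only: heat_point_pt[OF br])
  qed
  then show ?thesis by (simp add: heat_map_def Let_def n(2))
qed

lemma heat_map_convex_ngons:
  assumes n: "n \<ge> 5" and lam: "lam > 0" and A: "A \<in> convex_ngons n"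
  shows "heat_map lam A \<in> convex_ngons n"
    and "T \<in> PGL3 \<Longrightarrow> heat_map lam (map T A) = map T (heat_map lam A)"
proof -
  obtain v where v: "convex_lift (int n) v" "\<And>i. A ! nat (i mod int n) = pt (v i)" and len: "length A = n"
    using convex_ngons_lift[OF A] by blast
  have w: "convex_lift (int n) (heat_lift lam v)"
    using convex_lift_heat_lift[OF v(1) _ lam] n by simp
  have br: "br (v (i - 1)) (v i) (v (i + 1)) \<noteq> 0" "br (v (i - 1)) (v i) (v (i + 2)) \<noteq> 0"
      "br (v (i - 1)) (v (i + 1)) (v (i + 2)) \<noteq> 0" "br (v i) (v (i + 1)) (v (i + 2)) \<noteq> 0" for i
    by (rule less_imp_neq[symmetric], rule convex_lift_pos[OF v(1)]; use n in simp)+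
  have H: "heat_map lam A = map (\<lambda>j. pt (heat_lift lam v (int j))) [0..<n]"
    using n len v(2) br by (intro heat_map_pt) auto
  then show "heat_map lam A \<in> convex_ngons n"
    using n by (intro convex_ngonsI[OF w]) auto
  assume "T \<in> PGL3"
  then obtain M where M: "invertible M" "T = proj_map M" by (auto simp: PGL3_def)
  then have detM: "det M \<noteq> 0" by (simp add: invertible_det_nz)
  have nz: "u i \<noteq> 0" if "convex_lift (int n) u" for u i
  proof -
    have "br (u i) (u (i + 1)) (u (i + 2)) > 0" using n by (intro convex_lift_pos[OF that]) auto
    then show ?thesis by (intro br_nonzeroD(1)) (rule less_imp_neq[symmetric])
  qed
  have "map T A ! nat (i mod int n) = pt (M *v v i)" for i
  proof -
    have "nat (i mod int n) < n" using n by (intro nat_mod_less) linarith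
    then show ?thesis using len v(2)[of i] nz[OF v(1)] by (simp add: M(2) proj_map_pt)
  qed
  \<comment> \<open>The transformed lift has brackets of the sign of \<open>det M\<close>, so it is
    used through nonvanishing rather than positivity.\<close>
  then have "heat_map lam (map T A) = map (\<lambda>j. pt (heat_lift lam (\<lambda>i. M *v v i) (int j))) [0..<n]"
    using n len br detM by (intro heat_map_pt) (auto simp: br_matrix)
  \<comment> \<open>Every coefficient of the heat vector is linear in a single bracket, so exactly
    one factor \<open>det M\<close> comes out.\<close>
  moreover have "heat_lift lam (\<lambda>i. M *v v i) j = det M *\<^sub>R (M *v heat_lift lam v j)" for j
    by (simp add: heat_lift_def heat_vec_def outer_def br_matrix matrix_vector_right_distrib
        matrix_vector_mult_diff_distrib matrix_vector_mult_scaleR algebra_simps)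
  moreover have "map (\<lambda>j. pt (det M *\<^sub>R (M *v heat_lift lam v (int j)))) [0..<n] = map T (heat_map lam A)"
    using detM nz[OF w] by (simp add: H M(2) proj_map_pt pt_scaleR)
  ultimately show "heat_map lam (map T A) = map T (heat_map lam A)" by simp
qed

theorem theorem1:
  fixes n :: nat and lam :: real
  assumes "n \<ge> 5" and "lam > 0"
  shows "heat_map lam ` convex_ngons n \<subseteq> convex_ngons n \<and>
         heat_map_class lam ` convex_classes n \<subseteq> convex_classes n"
proof (intro conjI image_subsetI)
  show "heat_map lam A \<in> convex_ngons n" if "A \<in> convex_ngons n" for A
    using heat_map_convex_ngons(1)[OF assms that] .
next
  fix X assume "X \<in> convex_classes n"
  then obtain A where A: "A \<in> convex_ngons n" "X = proj_equiv `` {A}"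
    by (auto simp: convex_classes_def quotient_def)
  \<comment> \<open>All representatives have images in one class, so the union defining
    \<open>heat_map_class\<close> collapses to it.\<close>
  have "proj_equiv `` {heat_map lam (map T A)} = proj_equiv `` {heat_map lam A}" if "T \<in> PGL3" for T
    using heat_map_convex_ngons(2)[OF assms A(1) that] proj_equiv_class_map[OF that] by simp
  moreover have "X = {map T A | T. T \<in> PGL3}" by (auto simp: A(2) proj_equiv_def)
  moreover have "A \<in> X"
    using id_PGL3 by (auto simp: A(2) proj_equiv_def intro!: bexI[of _ id])
  ultimately have "heat_map_class lam X = proj_equiv `` {heat_map lam A}"
    unfolding heat_map_class_def by blast
  then show "heat_map_class lam X \<in> convex_classes n"
    using heat_map_convex_ngons(1)[OF assms A(1)] by (simp add: convex_classes_def quotientI)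
qed

end
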